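(* Given fees $c_1,\dots,c_{n-1}\ge 0$ (with the formal convention $c_n=0$) and payoffs $w_1,\dots,w_n>0$, let $W_k=\sum_{i=k}^n w_i$, $W=W_1$, and $$M = W\cdot\max_{1\le k\le n}\left(\frac{c_k}{w_k}+\sum_{i=1}^{k-1}\frac{c_i}{W_{i+1}}\right).$$ Consider the 2-person $n$-stage game described in the context, with initial resources $A,B$ of players PI, PII, and assume $A,B>M$. Then the pair of strategies $\sigma_{n,A,B},\tau_{n,A,B}$ is a unique Nash equilibrium for the game, with expected total payoffs $\frac{AW}{A+B}$ for PI and $\frac{BW}{A+B}$ for PII. Furthermore, $\sigma_{n,A,B}$ and $\tau_{n,A,B}$ guarantee the expected payoffs $\frac{AW}{A+B}$ and $\frac{BW}{A+B}$ for PI and PII respectively (that is, at least this expected total payoff against every strategy of the opponent).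
   Context: The game. The data are: the number $n$ of stages; payoffs $w_k>0$ ($1\le k\le n$); initial resources $A,B\ge 0$ of players PI, PII; fees $c_k\ge 0$ ($1\le k\le n-1$), with the formal convention $c_n=0$. At stage $k$ the players have remaining resources $A_k,B_k$, with $A_1=A$, $B_1=B$. At stage $k$ PI and PII each decide on an investment, $x_k$ and $y_k$ respectively, with $0\le x_k\le A_k-c_k$ and $0\le y_k\le B_k-c_k$; if $A_k<c_k$ then PI may only invest $0$, and similarly for PII if $B_k<c_k$. (Thus investing $0$ is always allowed.) PI wins the stage with probability $\frac{x_k}{x_k+y_k}$ and PII with probability $\frac{y_k}{x_k+y_k}$; if $x_k=y_k=0$ then no player wins the stage. The winner of stage $k$ receives payoff $w_k$, and his resource is reduced by an additional $c_k$: if PI wins, $A_{k+1}=A_k-x_k-c_k$ and $B_{k+1}=B_k-y_k$; if PII wins, $A_{k+1}=A_k-x_k$ and $B_{k+1}=B_k-y_k-c_k$; if nobody wins, the resources are unchanged. The total payoff of a player is the sum of the $w_k$ over the stages he wins. Resources and payoffs are of different nature and cannot be interchanged. The strategies $\sigma_{n,A,B}$ and $\tau_{n,A,B}$. At stage $k$ with remaining resources $A_k,B_k$ let $$a_k=\frac{w_kA_k}{W_k}-\frac{A_kc_k}{A_k+B_k},\qquad b_k=\frac{w_kB_k}{W_k}-\frac{B_kc_k}{A_k+B_k}.$$ Under $\sigma_{n,A,B}$, PI invests $a_k$ at stage $k$ if that is allowed by the rules of the game, and otherwise invests $0$. Under $\tau_{n,A,B}$, PII invests $b_k$ at stage $k$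 if that is allowed, and otherwise invests $0$.
   Formalization: Strategies are pure and history-dependent; "unique" means every Nash equilibrium prescribes the same investments as σ, τ at all histories reached with positive probability in its own play, since strategies may differ at unreached histories without destroying equilibrium. *)

theory Defs
  imports "HOL-Probability.Probability_Mass_Function"
begin

datatype player = PlayerI | PlayerII

text \<open>
  An entry \<open>(x, y, v)\<close> of a history records the investments of PI and PII at a stage and
  the winner of that stage (\<open>None\<close> if nobody won). Histories list the most recent stage first.
\<close>

type_synonym history = "(real \<times> real \<times> player option) list"

type_synonym strategy = "history \<Rightarrow> real"

text \<open>Stages, as well as the indices of payoffs \<open>w\<close> and fees \<open>c\<close>, are counted from 1.\<close>

definition stage :: "history \<Rightarrow> nat" where
  "stage h = Suc (length h)"

fun investment :: "player \<Rightarrow> real \<times> real \<times> player option \<Rightarrow> real" where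
  "investment PlayerI (x, y, v) = x"
| "investment PlayerII (x, y, v) = y"

fun resource :: "(nat \<Rightarrow> real) \<Rightarrow> player \<Rightarrow> real \<Rightarrow> history \<Rightarrow> real" where
  "resource c p R [] = R"
| "resource c p R ((x, y, v) # h) =
     (case v of
        None \<Rightarrow> resource c p R h
      | Some q \<Rightarrow> resource c p R h - investment p (x, y, v)
                    - (if q = p then c (stage h) else 0))"

fun total_payoff :: "(nat \<Rightarrow> real) \<Rightarrow> player \<Rightarrow> history \<Rightarrow> real" where
  "total_payoff w p [] = 0"
| "total_payoff w p ((x, y, v) # h) =
     total_payoff w p h + (if v = Some p then w (stage h) else 0)"

definition allowed :: "real \<Rightarrow> real \<Rightarrow> real \<Rightarrow> bool" where
  "allowed R f x \<longleftrightarrow> x = 0 \<or> 0 \<le> x \<and> x \<le> R - f"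

text \<open>
  Strategies are pure, and may depend on the whole past: both players' investments and the
  winners of all earlier stages. The value at histories of length \<open>\<ge> n\<close> plays no role.
\<close>

definition strategies :: "nat \<Rightarrow> (nat \<Rightarrow> real) \<Rightarrow> player \<Rightarrow> real \<Rightarrow> strategy set" where
  "strategies n c p R =
     {s. \<forall>h. length h < n \<longrightarrow> allowed (resource c p R h) (c (stage h)) (s h)}"

definition winner :: "real \<Rightarrow> real \<Rightarrow> player option pmf" where
  "winner x y =
     (if x = 0 \<and> y = 0 then return_pmf None
      else map_pmf (\<lambda>b. Some (if b then PlayerI else PlayerII)) (bernoulli_pmf (x / (x + y))))"

text \<open>The distribution of the history after \<open>k\<close> stages.\<close>

primrec play :: "strategy \<Rightarrow> strategy \<Rightarrow> nat \<Rightarrow> history pmf" where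
  "play s t 0 = return_pmf []"
| "play s t (Suc k) =
     bind_pmf (play s t k) (\<lambda>h. map_pmf (\<lambda>v. (s h, t h, v) # h) (winner (s h) (t h)))"

definition expected_payoff ::
  "nat \<Rightarrow> (nat \<Rightarrow> real) \<Rightarrow> player \<Rightarrow> strategy \<Rightarrow> strategy \<Rightarrow> real" where
  "expected_payoff n w p s t = measure_pmf.expectation (play s t n) (total_payoff w p)"

definition nash_equilibrium ::
  "nat \<Rightarrow> (nat \<Rightarrow> real) \<Rightarrow> (nat \<Rightarrow> real) \<Rightarrow> real \<Rightarrow> real \<Rightarrow> strategy \<Rightarrow> strategy \<Rightarrow> bool" where
  "nash_equilibrium n w c A B s t \<longleftrightarrow>
     s \<in> strategies n c PlayerI A \<and> t \<in> strategies n c PlayerII B \<and>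
     (\<forall>s' \<in> strategies n c PlayerI A.
        expected_payoff n w PlayerI s' t \<le> expected_payoff n w PlayerI s t) \<and>
     (\<forall>t' \<in> strategies n c PlayerII B.
        expected_payoff n w PlayerII s t' \<le> expected_payoff n w PlayerII s t)"

definition W_from :: "nat \<Rightarrow> (nat \<Rightarrow> real) \<Rightarrow> nat \<Rightarrow> real" where
  "W_from n w k = (\<Sum>i = k..n. w i)"

definition sigma_strategy :: "nat \<Rightarrow> (nat \<Rightarrow> real) \<Rightarrow> (nat \<Rightarrow> real) \<Rightarrow> real \<Rightarrow> real \<Rightarrow> strategy" where
  "sigma_strategy n w c A B h =
     (let k = stage h; Ak = resource c PlayerI A h; Bk = resource c PlayerII B h;
          a = w k * Ak / W_from n w k - Ak * c k / (Ak + Bk)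
      in if allowed Ak (c k) a then a else 0)"

definition tau_strategy :: "nat \<Rightarrow> (nat \<Rightarrow> real) \<Rightarrow> (nat \<Rightarrow> real) \<Rightarrow> real \<Rightarrow> real \<Rightarrow> strategy" where
  "tau_strategy n w c A B h =
     (let k = stage h; Ak = resource c PlayerI A h; Bk = resource c PlayerII B h;
          b = w k * Bk / W_from n w k - Bk * c k / (Ak + Bk)
      in if allowed Bk (c k) b then b else 0)"

text \<open>
  Uniqueness of a Nash equilibrium is understood up to the behaviour at histories that occur with
  probability 0: a player may change his strategy slightly at histories that only a losing
  deviation of the opponent can lead to, without destroying the equilibrium. So the requirement
  is that every Nash equilibrium prescribes the same investments as \<open>s, t\<close> throughout its own
  play (hence has the same distribution of play).
\<close>

definition unique_nash_equilibrium ::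
  "nat \<Rightarrow> (nat \<Rightarrow> real) \<Rightarrow> (nat \<Rightarrow> real) \<Rightarrow> real \<Rightarrow> real \<Rightarrow> strategy \<Rightarrow> strategy \<Rightarrow> bool" where
  "unique_nash_equilibrium n w c A B s t \<longleftrightarrow>
     nash_equilibrium n w c A B s t \<and>
     (\<forall>s' t'. nash_equilibrium n w c A B s' t' \<longrightarrow>
        (\<forall>k < n. \<forall>h \<in> set_pmf (play s' t' k). s' h = s h \<and> t' h = t h))"

definition threshold :: "nat \<Rightarrow> (nat \<Rightarrow> real) \<Rightarrow> (nat \<Rightarrow> real) \<Rightarrow> real" where
  "threshold n w c =
     W_from n w 1 *
       Max ((\<lambda>k. c k / w k + (\<Sum>i = 1..<k. c i / W_from n w (i + 1))) ` {1..n})"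

end

theory Submission
  imports Defs
begin

text \<open>
  A player with resource \<open>R\<close>, facing an opponent with resource \<open>R'\<close> while payoffs of total
  \<open>W\<^sub>k\<close> are still to be distributed, should expect the proportional part \<open>R * W\<^sub>k / (R + R')\<close> of
  them. Adding this quantity to the payoff that PI has already collected gives a potential. When
  PI invests \<open>a\<^sub>k\<close>, the expected potential after the stage, as a function of PII's investment \<open>y\<close>,
  exceeds the current one by a positive multiple of \<open>(y - b\<^sub>k)\<^sup>2\<close>: the winner's additional fee
  is paid whoever wins, so the sum of the resources after the stage is not random, the gain
  is a quotient of two quadratics in \<open>y\<close>, and the investment \<open>a\<^sub>k\<close> is chosen so that
  its numerator has a double root (\<open>stage_gain_identity\<close>). Hence under \<open>\<sigma>\<close> the
  potential is a submartingale; it starts at \<open>A * W / (A + B)\<close> and ends at PI's total payoff.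

  The identity only helps if \<open>a\<^sub>k\<close> is a legal investment. The assumption \<open>A > M\<close> is made for
  this. Investing \<open>a\<^sub>k\<close> can lower the ratio \<open>A\<^sub>k / W\<^sub>k\<close> by at most \<open>c\<^sub>k / W\<^bsub>k+1\<^esub>\<close>,
  whatever the opponent does; so \<open>A / W > M / W\<close> keeps \<open>A\<^sub>k / W\<^sub>k\<close> above
  \<open>c\<^sub>k / w\<^sub>k\<close> at every stage, which makes \<open>a\<^sub>k\<close> positive and affordable
  (\<open>funded_Suc\<close>, \<open>share_legal\<close>). This gives the guarantee for \<open>\<sigma>\<close>, and exchanging the two
  players gives the one for \<open>\<tau>\<close>.

  Since \<open>a\<^sub>k > 0\<close>, under \<open>\<sigma>\<close> somebody wins every stage, and likewise under \<open>\<tau>\<close>, so against these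
  strategies the game is constant-sum and the two guarantees make \<open>\<sigma>, \<tau>\<close> an equilibrium. In any
  equilibrium \<open>s', t'\<close> both players get at least their guarantees, whose sum is the maximal total
  payoff \<open>W\<close>; so they get exactly these values, and neither \<open>t'\<close> against \<open>\<sigma>\<close> nor \<open>s'\<close> against
  \<open>\<tau>\<close> leaves the opponent more than his guarantee. The potential is then a martingale, so every
  square \<open>(y - b\<^sub>k)\<^sup>2\<close> met in play vanishes: \<open>t'\<close> agrees with \<open>\<tau>\<close> on the play of
  \<open>\<sigma>, t'\<close>, which is therefore the play of \<open>\<sigma>, \<tau>\<close>; the same holds for \<open>s'\<close>, and thus the play
  of \<open>s', t'\<close> is the play of \<open>\<sigma>, \<tau>\<close> as well.
\<close>

section \<open>The gain in a single stage\<close>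

text \<open>
  The heart of the matter. With \<open>z = x + y\<close>, both sides times \<open>z * (A + B - c - z)\<close> are quadratic
  polynomials in \<open>z\<close>. They agree because \<open>x\<close> is chosen so that the left one has
  \<open>(w / W) * (A + B) - c\<close>, the sum of the two proportional investments, as a double root.
\<close>

lemma stage_gain_identity:
  fixes A B W W' w c x y :: real
  assumes "0 < A" "0 \<le> B" "0 < W" and w: "w = W - W'"
    and x: "x = w * A / W - A * c / (A + B)" and "0 < x" "0 \<le> y" "x + y + c < A + B"
  shows "x / (x + y) * (w + (A - x - c) * W' / ((A - x - c) + (B - y)))
       + (1 - x / (x + y)) * ((A - x) * W' / ((A - x) + (B - y - c))) - A * W / (A + B)
     = A * W / (A + B) * (y - (w * B / W - B * c / (A + B)))\<^sup>2 / ((x + y) * (A + B - c - (x + y)))"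
proof -
  \<comment> \<open>In terms of the fee and the investment per unit of total resource, \<open>e\<close> and \<open>q\<close>, the
      investments are \<open>A * q\<close> and \<open>B * q\<close>, and the only division left is by \<open>z * D\<close>.\<close>
  define S z D e q where defs: "S = A + B" "z = x + y" "D = S - c - z" "e = c / S" "q = w / W - e"
  have pos: "S > 0" "z > 0" "D > 0" using assms by (auto simp: defs)
  have c: "c = e * S" using pos by (simp add: defs)
  have x': "x = A * q" using assms by (simp add: defs right_diff_distrib mult.commute)
  have b: "w * B / W - B * c / (A + B) = B * q" by (simp add: defs right_diff_distrib mult.commute)
  have w': "w = W * (q + e)" using \<open>0 < W\<close> by (simp add: defs)
  have W': "W' = W * (1 - q - e)" using w w' by (simp add: algebra_simps)
  have y: "y = z - A * q" using x' defs by simp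
  have poly: "S * q * (q + e) * D + S * (1 - q - e) * ((1 - q) * z - e * S * q) - z * D
      = (z - S * q)\<^sup>2"
    unfolding defs(3) c by (simp add: algebra_simps power2_eq_square)
  have "x / (x + y) * (w + (A - x - c) * W' / ((A - x - c) + (B - y)))
       + (1 - x / (x + y)) * ((A - x) * W' / ((A - x) + (B - y - c))) - A * W / (A + B)
     = x / z * (w + (A - x - c) * W' / D) + (1 - x / z) * ((A - x) * W' / D) - A * W / S"
    by (simp add: defs algebra_simps)
  also have "\<dots> = (x * w * D + W' * ((A - x) * z - c * x)) / (z * D) - A * W / S"
    using pos by (simp add: field_simps)
  also have "x * w * D + W' * ((A - x) * z - c * x)
      = A * W * (q * (q + e) * D + (1 - q - e) * ((1 - q) * z - e * S * q))"
    unfolding w' W' x' c by (simp add: algebra_simps)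
  also have "\<dots> / (z * D) - A * W / S
      = A * W * (S * q * (q + e) * D + S * (1 - q - e) * ((1 - q) * z - e * S * q) - z * D) / (S * (z * D))"
    using pos by (simp add: field_simps)
  also have "\<dots> = A * W / S * (z - S * q)\<^sup>2 / (z * D)"
    unfolding poly by simp
  also have "z - S * q = y - B * q"
    by (simp add: y defs(1) algebra_simps)
  finally show ?thesis
    unfolding b by (simp add: defs)
qed

section \<open>Winners and plays\<close>

lemma expectation_winner:
  fixes f :: "player option \<Rightarrow> real"
  assumes "0 < x" "0 \<le> y"
  shows "measure_pmf.expectation (winner x y) f
    = x / (x + y) * f (Some PlayerI) + (1 - x / (x + y)) * f (Some PlayerII)"
  using assms by (simp add: winner_def)

lemma set_winner:
  assumes "0 < x" "0 \<le> y"
  shows "set_pmf (winner x y) = insert (Some PlayerI) (if y = 0 then {} else {Some PlayerII})"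
proof (cases "y = 0")
  case False
  then have "0 < x / (x + y)" "x / (x + y) < 1" using assms by auto
  then show ?thesis using assms False by (auto simp: winner_def set_pmf_bernoulli UNIV_bool)
next
  case True
  have "bernoulli_pmf 1 = return_pmf True"
  proof (rule pmf_eqI)
    show "pmf (bernoulli_pmf 1) b = pmf (return_pmf True) b" for b by (cases b) simp_all
  qed
  then show ?thesis using assms True by (simp add: winner_def)
qed

lemma finite_set_winner: "finite (set_pmf (winner x y))"
  by (simp add: winner_def)

lemma finite_set_play: "finite (set_pmf (play s t k))"
  by (induction k) (auto simp: finite_set_winner)

lemma length_play: "h \<in> set_pmf (play s t k) \<Longrightarrow> length h = k"
  by (induction k arbitrary: h) auto

lemma expectation_play_Suc:
  fixes f :: "history \<Rightarrow> real"
  shows "measure_pmf.expectation (play s t (Suc k)) f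
    = measure_pmf.expectation (play s t k)
        (\<lambda>h. measure_pmf.expectation (winner (s h) (t h)) (\<lambda>v. f ((s h, t h, v) # h)))"
  by (simp add: pmf_expectation_bind[OF finite_set_play _ order_refl] finite_set_winner
      integral_measure_pmf_real[OF finite_set_play] mult.commute)

lemma play_cong:
  assumes "\<And>j h. j < k \<Longrightarrow> h \<in> set_pmf (play s t j) \<Longrightarrow> s h = s' h \<and> t h = t' h"
  shows "play s t k = play s' t' k"
  using assms
proof (induction k)
  case (Suc k)
  have "play s t k = play s' t' k" by (rule Suc.IH) (use Suc.prems less_SucI in blast)
  with Suc.prems[of k] show ?case by (auto intro!: bind_pmf_cong)
qed simp

lemma strategies_nonneg: "s \<in> strategies n c p R \<Longrightarrow> length h < n \<Longrightarrow> 0 \<le> s h"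
  by (auto simp: strategies_def allowed_def)

section \<open>Exchanging the players\<close>

fun opponent :: "player \<Rightarrow> player" where
  "opponent PlayerI = PlayerII"
| "opponent PlayerII = PlayerI"

lemma opponent_eq_iff [simp]: "opponent p = opponent q \<longleftrightarrow> p = q"
  by (cases p; cases q) auto

lemma opponent_opponent [simp]: "opponent (opponent p) = p"
  by (cases p) auto

definition mirror :: "history \<Rightarrow> history" where
  "mirror = map (\<lambda>(x, y, v). (y, x, map_option opponent v))"

lemma mirror_simps [simp]:
  "mirror [] = []"
  "mirror ((x, y, v) # h) = (y, x, map_option opponent v) # mirror h"
  "length (mirror h) = length h"
  "stage (mirror h) = stage h"
  by (auto simp: mirror_def stage_def)

lemma mirror_mirror [simp]: "mirror (mirror h) = h"
  by (induction h) (auto simp: option.map_comp comp_def option.map_ident)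

lemma resource_mirror [simp]: "resource c p R (mirror h) = resource c (opponent p) R h"
proof (induction h)
  case (Cons e h)
  obtain x y v where "e = (x, y, v)" by (cases e)
  with Cons show ?case by (cases p; cases v) (auto, (metis opponent.simps player.exhaust)+)
qed simp

lemma total_payoff_mirror [simp]: "total_payoff w p (mirror h) = total_payoff w (opponent p) h"
  by (induction w p h rule: total_payoff.induct) auto

lemma strategies_mirror:
  "s \<in> strategies n c p R \<Longrightarrow> s \<circ> mirror \<in> strategies n c (opponent p) R"
  unfolding strategies_def mem_Collect_eq
  by (metis comp_apply mirror_simps(3,4) opponent_opponent resource_mirror)

lemma winner_mirror:
  assumes "0 \<le> x" "0 \<le> y"
  shows "winner y x = map_pmf (map_option opponent) (winner x y)"
proof (cases "x = 0 \<and> y = 0")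
  case False
  define p where "p = x / (x + y)"
  have "x + y > 0" using assms False by linarith
  then have p: "0 \<le> p" "p \<le> 1" "y / (y + x) = 1 - p"
    using assms by (auto simp: p_def field_simps)
  have "bernoulli_pmf (1 - p) = map_pmf Not (bernoulli_pmf p)"
  proof (rule pmf_eqI)
    fix b
    have "pmf (map_pmf Not (bernoulli_pmf p)) (\<not> \<not> b) = pmf (bernoulli_pmf p) (\<not> b)"
      by (rule pmf_map_inj') (simp add: inj_def)
    then show "pmf (bernoulli_pmf (1 - p)) b = pmf (map_pmf Not (bernoulli_pmf p)) b"
      using p by (cases b) auto
  qed
  then show ?thesis using False p unfolding winner_def p_def[symmetric]
    by (auto simp: pmf.map_comp comp_def intro!: map_pmf_cong)
qed (auto simp: winner_def)

text \<open>
  The game is symmetric, so every statement about \<open>\<sigma>\<close> transfers to \<open>\<tau>\<close>. Nonnegativity is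
  required since the winning chance \<open>x / (x + y)\<close> is a probability only for nonnegative investments.
\<close>

lemma play_mirror:
  assumes "\<And>h. length h < k \<Longrightarrow> 0 \<le> s h \<and> 0 \<le> t h"
  shows "play (t \<circ> mirror) (s \<circ> mirror) k = map_pmf mirror (play s t k)"
  using assms
proof (induction k)
  case (Suc k)
  have "play (t \<circ> mirror) (s \<circ> mirror) k = map_pmf mirror (play s t k)"
    by (rule Suc.IH) (use Suc.prems less_SucI in blast)
  moreover have "winner (t h) (s h) = map_pmf (map_option opponent) (winner (s h) (t h))"
    if "h \<in> set_pmf (play s t k)" for h
    using that Suc.prems length_play by (intro winner_mirror) auto
  ultimately show ?case
    by (auto simp: bind_map_pmf map_bind_pmf pmf.map_comp comp_def intro!: bind_pmf_cong)
qed simp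

lemma expected_payoff_mirror:
  assumes "s \<in> strategies n c p R" "t \<in> strategies n c q R'"
  shows "expected_payoff n w r (t \<circ> mirror) (s \<circ> mirror) = expected_payoff n w (opponent r) s t"
proof -
  have "play (t \<circ> mirror) (s \<circ> mirror) n = map_pmf mirror (play s t n)"
    using assms by (intro play_mirror) (auto dest: strategies_nonneg)
  then show ?thesis by (simp add: expected_payoff_def)
qed

lemma tau_eq_mirrored_sigma: "tau_strategy n w c A B = sigma_strategy n w c B A \<circ> mirror"
  by (rule ext) (simp add: tau_strategy_def sigma_strategy_def Let_def add.commute)

lemma sigma_in_strategies: "sigma_strategy n w c A B \<in> strategies n c PlayerI A"
  by (simp add: strategies_def sigma_strategy_def Let_def allowed_def)

lemma tau_in_strategies: "tau_strategy n w c A B \<in> strategies n c PlayerII B"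
  using strategies_mirror[OF sigma_in_strategies] unfolding tau_eq_mirrored_sigma by simp

section \<open>Resources that suffice for proportional investments\<close>

locale fee_game =
  fixes n :: nat and w c :: "nat \<Rightarrow> real"
  assumes w_pos: "k \<in> {1..n} \<Longrightarrow> 0 < w k"
    and c_nonneg: "k \<in> {1..n} \<Longrightarrow> 0 \<le> c k"
    and c_last: "c n = 0"
begin

abbreviation W :: "nat \<Rightarrow> real" where "W \<equiv> W_from n w"

lemma W_rec: "k \<le> n \<Longrightarrow> W k = w k + W (Suc k)"
  by (simp add: W_from_def sum.atLeast_Suc_atMost)

lemma W_beyond [simp]: "W (Suc n) = 0"
  by (simp add: W_from_def)

lemma W_pos: "k \<in> {1..n} \<Longrightarrow> 0 < W k"
  unfolding W_from_def by (rule sum_pos) (auto intro: w_pos)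

text \<open>
  The threshold condition of the theorem for the game that begins at stage \<open>k\<close>, divided by \<open>W k\<close>;
  in this scaling it passes from one stage to the next. For \<open>k > n\<close> it is vacuous.
\<close>

definition funded :: "nat \<Rightarrow> real \<Rightarrow> bool" where
  "funded k R \<longleftrightarrow> (\<forall>j\<in>{k..n}. c j / w j + (\<Sum>i = k..<j. c i / W (i + 1)) < R / W k)"

lemma funded_fee:
  assumes "funded k R" "k \<in> {1..n}"
  shows "c k * W k < w k * R"
proof -
  have "c k / w k < R / W k" using assms by (force simp: funded_def)
  then show ?thesis using w_pos[OF assms(2)] W_pos[OF assms(2)] by (simp add: field_simps)
qed

lemma funded_pos:
  assumes "funded k R" "k \<in> {1..n}"
  shows "0 < R"
proof -
  have "0 \<le> c k * W k" using assms(2) c_nonneg W_pos[OF assms(2)] by simp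
  with funded_fee[OF assms] w_pos[OF assms(2)] show ?thesis
    by (meson le_less_trans zero_less_mult_pos)
qed

lemma funded_future_fee:
  assumes "funded k R" "k \<in> {1..<n}"
  shows "c k < R * W (Suc k) / W k"
proof -
  have "c (Suc k) / w (Suc k) + c k / W (Suc k) < R / W k"
    using bspec[OF assms(1)[unfolded funded_def], of "Suc k"] assms(2) by simp
  moreover have "0 \<le> c (Suc k) / w (Suc k)" using assms w_pos[of "Suc k"] c_nonneg[of "Suc k"] by auto
  ultimately have "c k / W (Suc k) < R / W k" by linarith
  then show ?thesis using W_pos[of k] W_pos[of "Suc k"] assms(2) by (simp add: field_simps)
qed

text \<open>
  The fee \<open>c k\<close>, measured in units of \<open>W (Suc k)\<close>, is exactly the term that all later thresholds
  lose when stage \<open>k\<close> is over.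
\<close>

lemma funded_Suc:
  assumes "funded k R" "k \<in> {1..<n}" and R': "R * W (Suc k) / W k - c k \<le> R'"
  shows "funded (Suc k) R'"
  unfolding funded_def
proof
  fix j assume j: "j \<in> {Suc k..n}"
  have pos: "0 < W k" "0 < W (Suc k)" using W_pos assms(2) by auto
  have "c j / w j + (\<Sum>i = k..<j. c i / W (i + 1)) < R / W k"
    using assms(1) j by (auto simp: funded_def)
  moreover have "(\<Sum>i = k..<j. c i / W (i + 1)) = c k / W (Suc k) + (\<Sum>i = Suc k..<j. c i / W (i + 1))"
    using j by (simp add: sum.atLeast_Suc_lessThan)
  moreover have "R / W k - c k / W (Suc k) \<le> R' / W (Suc k)"
    using divide_right_mono[OF R', of "W (Suc k)"] pos by (simp add: diff_divide_distrib)
  ultimately show "c j / w j + (\<Sum>i = Suc k..<j. c i / W (i + 1)) < R' / W (Suc k)" by linarith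
qed

lemma funded_one_if_threshold:
  assumes "threshold n w c < R" "1 \<le> n"
  shows "funded 1 R"
  unfolding funded_def
proof
  fix j assume j: "j \<in> {1..n}"
  let ?f = "\<lambda>k. c k / w k + (\<Sum>i = 1..<k. c i / W (i + 1))"
  have "?f j \<le> Max (?f ` {1..n})" using j by (intro Max_ge) auto
  also have "\<dots> < R / W 1"
    using assms W_pos[of 1] by (simp add: threshold_def pos_less_divide_eq mult.commute)
  finally show "?f j < R / W 1" .
qed

text \<open>
  The investments \<open>a\<^sub>k\<close> and \<open>b\<^sub>k\<close>: the first resource argument is the investor's, the second
  his opponent's.
\<close>

definition share :: "nat \<Rightarrow> real \<Rightarrow> real \<Rightarrow> real" where
  "share k R R' = w k * R / W k - R * c k / (R + R')"

text \<open>
  Only the investor's own resource has to be large: what he keeps after investing is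
  \<open>R * W (Suc k) / W k + R * c k / (R + R')\<close>, and already its first summand covers the fee. The
  second conclusion is the hypothesis of \<open>funded_Suc\<close> in the worst case, a win with its fee.
\<close>

lemma share_legal:
  assumes k: "k \<in> {1..n}" and "funded k R" "0 \<le> R'"
  shows "0 < share k R R'"
    and "R * W (Suc k) / W k - c k \<le> R - share k R R' - c k"
    and "0 \<le> R - share k R R' - c k"
    and "k < n \<Longrightarrow> 0 < R - share k R R' - c k"
proof -
  have R: "0 < R" using funded_pos assms by blast
  have Wk: "0 < W k" using W_pos k by blast
  have c: "0 \<le> c k" using c_nonneg k by blast
  have "c k / (R + R') \<le> c k / R" using R c \<open>0 \<le> R'\<close> by (intro divide_left_mono) auto
  also have "\<dots> < w k / W k" using funded_fee[OF assms(2,1)] R Wk by (simp add: field_simps)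
  finally have "0 < R * (w k / W k - c k / (R + R'))" using R by simp
  then show "0 < share k R R'" by (simp add: share_def algebra_simps)
  have rest: "R - share k R R' = R * W (Suc k) / W k + R * c k / (R + R')"
    using Wk W_rec[of k] k by (simp add: share_def field_simps)
  then show 2: "R * W (Suc k) / W k - c k \<le> R - share k R R' - c k"
    using R c \<open>0 \<le> R'\<close> by simp
  show 4: "0 < R - share k R R' - c k" if "k < n"
    using funded_future_fee[of k R] assms that 2 by auto
  show "0 \<le> R - share k R R' - c k"
  proof (cases "k = n")
    case True
    then show ?thesis using 2 c_last by simp
  qed (use 4 k in auto)
qed

lemma sigma_eq_share:
  assumes "length h < n" "funded (stage h) (resource c PlayerI A h)" "0 \<le> resource c PlayerII B h"
  shows "sigma_strategy n w c A B h
    = share (stage h) (resource c PlayerI A h) (resource c PlayerII B h)"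
proof -
  have "stage h \<in> {1..n}" using assms by (simp add: stage_def)
  from share_legal(1,3)[OF this assms(2,3)] show ?thesis
    by (simp add: sigma_strategy_def Let_def allowed_def share_def)
qed

section \<open>The potential\<close>

lemma total_payoffs_le:
  assumes "length h \<le> n"
  shows "total_payoff w PlayerI h + total_payoff w PlayerII h \<le> W 1 - W (stage h)"
  using assms
proof (induction h)
  case Nil
  then show ?case by (simp add: stage_def)
next
  case (Cons e h)
  obtain x y v where e: "e = (x, y, v)" by (cases e)
  have "0 < w (stage h)" "W (stage h) = w (stage h) + W (stage (e # h))"
    using Cons.prems w_pos W_rec[of "stage h"] by (auto simp: stage_def)
  then show ?case using Cons by (auto simp: e)
qed

text \<open>
  PI's payoff so far plus his proportional part of the payoffs still to come. After stage \<open>n\<close> both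
  resources may be \<open>0\<close>, but then the second summand is \<open>0\<close> in any case, since
  \<open>W (Suc n) = 0\<close>.
\<close>

definition potential :: "real \<Rightarrow> real \<Rightarrow> history \<Rightarrow> real" where
  "potential A B h = total_payoff w PlayerI h
     + resource c PlayerI A h * W (stage h) / (resource c PlayerI A h + resource c PlayerII B h)"

text \<open>
  The identity needs a positive total resource after the stage, which is guaranteed when further
  stages follow. At the last stage PI invests everything, PII may do the same, and the gain
  is computed directly.
\<close>

lemma potential_gain:
  fixes A B :: real and h :: history and y :: real
  defines "a \<equiv> sigma_strategy n w c A B h"
  assumes h: "length h < n" and fund: "funded (stage h) (resource c PlayerI A h)"
    and res: "0 \<le> resource c PlayerII B h"
    and y: "allowed (resource c PlayerII B h) (c (stage h)) y"
  shows "potential A B h \<le> measure_pmf.expectation (winner a y) (\<lambda>v. potential A B ((a, y, v) # h))"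
    and "measure_pmf.expectation (winner a y) (\<lambda>v. potential A B ((a, y, v) # h)) = potential A B h
      \<Longrightarrow> y = tau_strategy n w c A B h"
proof -
  define k where "k = stage h"
  define R R' where "R = resource c PlayerI A h" and "R' = resource c PlayerII B h"
  have k: "k \<in> {1..n}" using h by (simp add: k_def stage_def)
  have a: "a = share k R R'" unfolding a_def k_def R_def R'_def by (rule sigma_eq_share[OF h fund res])
  have R: "0 < R" using fund funded_pos k by (simp add: k_def R_def)
  have R': "0 \<le> R'" using res by (simp add: R'_def)
  have y0: "0 \<le> y" using y by (auto simp: allowed_def)
  have Wk: "0 < W k" using W_pos k by blast
  have legal: "0 < a" "0 \<le> R - a - c k" "k < n \<Longrightarrow> 0 < R - a - c k"
    using share_legal[OF k, of R R'] fund R' by (auto simp: a k_def R_def)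
  have yR': "y \<le> R'" using y R' c_nonneg[OF k] by (auto simp: allowed_def R'_def k_def)
  define b where "b = share k R' R"
  let ?gain = "measure_pmf.expectation (winner a y) (\<lambda>v. potential A B ((a, y, v) # h)) - potential A B h"
  have gain: "?gain = a / (a + y) * (w k + (R - a - c k) * W (Suc k) / ((R - a - c k) + (R' - y)))
       + (1 - a / (a + y)) * ((R - a) * W (Suc k) / ((R - a) + (R' - y - c k))) - R * W k / (R + R')"
    unfolding expectation_winner[OF legal(1) y0]
    by (simp add: potential_def R_def[symmetric] R'_def[symmetric] k_def[symmetric] algebra_simps)
       (simp add: k_def stage_def)
  have sign: "0 \<le> ?gain \<and> (?gain = 0 \<longrightarrow> y = b)"
  proof (cases "k = n")
    case False
    with k have "k < n" by auto
    have less: "a + y + c k < R + R'" using legal(3)[OF \<open>k < n\<close>] yR' by linarith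
    have g: "?gain = R * W k / (R + R') * (y - b)\<^sup>2 / ((a + y) * (R + R' - c k - (a + y)))"
      unfolding gain b_def share_def
      using stage_gain_identity[OF R R' Wk _ _ legal(1) y0 less, of "w k" "W (Suc k)"] W_rec[of k] k
      by (simp add: a share_def add.commute)
    show ?thesis unfolding g using R R' Wk less legal(1) y0 by simp
  next
    case True
    have W: "W (Suc k) = 0" "c k = 0" "W k = w k" using True c_last W_rec[of k] by auto
    \<comment> \<open>Without a fee and a future, the proportional investments are the whole resources.\<close>
    have ab: "a = R" "b = R'" using W Wk by (auto simp: a b_def share_def)
    have g: "?gain = R * W k * (R' - y) / ((R + y) * (R + R'))"
      unfolding gain unfolding W ab using R R' y0 by (simp add: field_simps)
    have pos: "0 < (R + y) * (R + R')" "0 < R * W k" using R R' y0 Wk by simp_all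
    have "0 \<le> ?gain"
      unfolding g using yR' mult_nonneg_nonneg[OF less_imp_le[OF pos(2)], of "R' - y"]
        divide_nonneg_pos[OF _ pos(1)] by simp
    moreover have "y = b" if "?gain = 0"
    proof -
      have "R * W k * (R' - y) = 0"
        using that pos(1) unfolding g by (simp only: divide_eq_0_iff) linarith
      then have "R' - y = 0"
        using pos(2) mult_eq_0_iff[of "R * W k" "R' - y"] by linarith
      then show ?thesis by (simp add: ab(2))
    qed
    ultimately show ?thesis by blast
  qed
  have tau: "tau_strategy n w c A B h = y" if "y = b"
    using y that unfolding tau_strategy_def b_def share_def Let_def
    by (simp add: R_def R'_def k_def add.commute)
  from sign show "potential A B h
      \<le> measure_pmf.expectation (winner a y) (\<lambda>v. potential A B ((a, y, v) # h))"
    by linarith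
  show "y = tau_strategy n w c A B h"
    if "measure_pmf.expectation (winner a y) (\<lambda>v. potential A B ((a, y, v) # h)) = potential A B h"
    using sign that tau by (metis diff_self)
qed

text \<open>
  The invariants of a play in which PI follows \<open>\<sigma>\<close> and PII does whatever he likes. The last one
  says that every stage was won by somebody, which holds because PI always invests a positive amount.
\<close>

lemma play_against_sigma:
  assumes A: "funded 1 A" and B: "0 \<le> B" and t: "t \<in> strategies n c PlayerII B"
    and "k \<le> n" "h \<in> set_pmf (play (sigma_strategy n w c A B) t k)"
  shows "(k < n \<longrightarrow> funded (Suc k) (resource c PlayerI A h)) \<and> 0 \<le> resource c PlayerII B h
    \<and> total_payoff w PlayerI h + total_payoff w PlayerII h = W 1 - W (Suc k)"
  using assms(4,5)
proof (induction k arbitrary: h)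
  case 0
  then show ?case using A B by simp
next
  case (Suc k)
  let ?s = "sigma_strategy n w c A B"
  from Suc.prems obtain g v where g: "g \<in> set_pmf (play ?s t k)"
    and v: "v \<in> set_pmf (winner (?s g) (t g))" and h: "h = (?s g, t g, v) # g" by auto
  have lg: "length g = k" "k < n" using g length_play Suc.prems by auto
  have IH: "funded (Suc k) (resource c PlayerI A g)" "0 \<le> resource c PlayerII B g"
    "total_payoff w PlayerI g + total_payoff w PlayerII g = W 1 - W (Suc k)"
    using Suc.IH[OF _ g] lg by auto
  have k: "Suc k \<in> {1..n}" and st: "stage g = Suc k" using lg by (auto simp: stage_def)
  have s: "?s g = share (Suc k) (resource c PlayerI A g) (resource c PlayerII B g)"
    using sigma_eq_share[of g A B] IH lg by (simp add: st)
  note legal = share_legal[OF k IH(1,2), folded s]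
  have allowed: "allowed (resource c PlayerII B g) (c (Suc k)) (t g)"
    using t lg by (auto simp: strategies_def st[symmetric])
  have t0: "0 \<le> t g" using allowed by (auto simp: allowed_def)
  have c: "0 \<le> c (Suc k)" using c_nonneg k by blast
  \<comment> \<open>PII cannot win with investment \<open>0\<close>, so he has covered the fee whenever he pays it.\<close>
  have v': "v = Some PlayerI \<or> v = Some PlayerII \<and> t g \<noteq> 0"
    using v legal(1) t0 by (auto simp: set_winner split: if_splits)
  have fund: "funded (Suc (Suc k)) (resource c PlayerI A h)" if "Suc k < n"
    by (rule funded_Suc[OF IH(1)]) (use that v' legal(2) c in \<open>auto simp: h st\<close>)
  have res: "0 \<le> resource c PlayerII B h"
    using v' allowed IH(2) c by (auto simp: h st allowed_def)
  have "total_payoff w PlayerI h + total_payoff w PlayerII h = W 1 - W (Suc (Suc k))"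
    using v' IH(3) W_rec[of "Suc k"] k by (auto simp: h st)
  with fund res show ?case by blast
qed

text \<open>
  Averaging the gains of a stage: they are nonnegative, so if their mean is \<open>0\<close> then each of them
  is \<open>0\<close>, which forces PII's investment to be that of \<open>\<tau>\<close>.
\<close>

lemma potential_against_sigma:
  fixes A B t
  defines "E \<equiv> (\<lambda>k. measure_pmf.expectation (play (sigma_strategy n w c A B) t k) (potential A B))"
  assumes A: "funded 1 A" and B: "0 \<le> B" and t: "t \<in> strategies n c PlayerII B" and k: "k < n"
  shows "E k \<le> E (Suc k)"
    and "E (Suc k) = E k \<Longrightarrow> h \<in> set_pmf (play (sigma_strategy n w c A B) t k)
      \<Longrightarrow> t h = tau_strategy n w c A B h"
proof -
  let ?s = "sigma_strategy n w c A B"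
  let ?next = "\<lambda>h. measure_pmf.expectation (winner (?s h) (t h)) (\<lambda>v. potential A B ((?s h, t h, v) # h))"
  let ?p = "measure_pmf (play ?s t k)"
  have gain: "potential A B h \<le> ?next h" "?next h = potential A B h \<Longrightarrow> t h = tau_strategy n w c A B h"
    if h: "h \<in> set_pmf (play ?s t k)" for h
  proof -
    have lh: "length h = k" using length_play h by blast
    have "length h < n" "funded (stage h) (resource c PlayerI A h)" "0 \<le> resource c PlayerII B h"
      "allowed (resource c PlayerII B h) (c (stage h)) (t h)"
      using play_against_sigma[OF A B t _ h] t k lh by (auto simp: stage_def strategies_def)
    from potential_gain[OF this]
    show "potential A B h \<le> ?next h" "?next h = potential A B h \<Longrightarrow> t h = tau_strategy n w c A B h"
      by auto
  qed
  have int: "integrable ?p f" for f :: "history \<Rightarrow> real"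
    by (rule integrable_measure_pmf_finite[OF finite_set_play])
  have diff: "E (Suc k) - E k = (\<integral>h. ?next h - potential A B h \<partial>?p)"
    unfolding E_def expectation_play_Suc by (simp add: Bochner_Integration.integral_diff int)
  have nonneg: "AE h in ?p. 0 \<le> ?next h - potential A B h"
    using gain(1) by (simp add: AE_measure_pmf_iff)
  show "E k \<le> E (Suc k)" using integral_nonneg_AE[OF nonneg] diff by linarith
  show "t h = tau_strategy n w c A B h" if "E (Suc k) = E k" "h \<in> set_pmf (play ?s t k)"
  proof -
    have "AE h in ?p. ?next h - potential A B h = 0"
      using integral_nonneg_eq_0_iff_AE[OF int nonneg] diff that(1) by simp
    then show ?thesis using gain(2) that(2) by (simp add: AE_measure_pmf_iff)
  qed
qed

section \<open>Guarantees\<close>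

text \<open>
  The expected potential increases along the play from \<open>A * W 1 / (A + B)\<close> to PI's expected payoff.
  If the two are equal, it stays constant throughout, and the equality case of every stage applies.
\<close>

lemma sigma_guarantee:
  assumes A: "funded 1 A" and B: "0 \<le> B" and t: "t \<in> strategies n c PlayerII B"
  shows "A * W 1 / (A + B) \<le> expected_payoff n w PlayerI (sigma_strategy n w c A B) t"
    and "expected_payoff n w PlayerI (sigma_strategy n w c A B) t = A * W 1 / (A + B)
      \<Longrightarrow> k < n \<Longrightarrow> h \<in> set_pmf (play (sigma_strategy n w c A B) t k)
      \<Longrightarrow> t h = tau_strategy n w c A B h"
proof -
  let ?s = "sigma_strategy n w c A B"
  define E where "E k = measure_pmf.expectation (play ?s t k) (potential A B)" for k
  have E0: "E 0 = A * W 1 / (A + B)" by (simp add: E_def potential_def stage_def)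
  have En: "E n = expected_payoff n w PlayerI ?s t"
    unfolding E_def expected_payoff_def
    by (intro integral_cong_AE) (auto simp: AE_measure_pmf_iff potential_def stage_def length_play)
  have E_le: "E k \<le> E (Suc k)" if "k < n" for k
    unfolding E_def by (rule potential_against_sigma(1)[OF A B t that])
  have mono: "E i \<le> E j" if "i \<le> j" "j \<le> n" for i j
    using that
  proof (induction j rule: dec_induct)
    case (step m)
    then show ?case using E_le[of m] by simp
  qed simp
  show "A * W 1 / (A + B) \<le> expected_payoff n w PlayerI ?s t"
    using mono[of 0 n] E0 En by simp
  show "t h = tau_strategy n w c A B h"
    if "expected_payoff n w PlayerI ?s t = A * W 1 / (A + B)" "k < n" "h \<in> set_pmf (play ?s t k)"
  proof -
    have "E (Suc k) = E k"
      using mono[of 0 k] mono[of k "Suc k"] mono[of "Suc k" n] E0 En that(1,2) by simp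
    then show ?thesis
      using potential_against_sigma(2)[OF A B t that(2) _ that(3)] by (simp add: E_def)
  qed
qed

lemma payoff_sum:
  "expected_payoff n w PlayerI s t + expected_payoff n w PlayerII s t
   = measure_pmf.expectation (play s t n) (\<lambda>h. total_payoff w PlayerI h + total_payoff w PlayerII h)"
  unfolding expected_payoff_def
  by (simp add: Bochner_Integration.integral_add integrable_measure_pmf_finite finite_set_play)

lemma payoff_sum_le:
  "expected_payoff n w PlayerI s t + expected_payoff n w PlayerII s t \<le> W 1"
  unfolding payoff_sum
proof (rule measure_pmf.integral_le_const)
  show "AE h in measure_pmf (play s t n). total_payoff w PlayerI h + total_payoff w PlayerII h \<le> W 1"
    using total_payoffs_le length_play by (fastforce simp: AE_measure_pmf_iff stage_def)
qed (simp add: integrable_measure_pmf_finite finite_set_play)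

lemma payoff_sum_sigma:
  assumes "funded 1 A" "0 \<le> B" "t \<in> strategies n c PlayerII B"
  shows "expected_payoff n w PlayerI (sigma_strategy n w c A B) t
    + expected_payoff n w PlayerII (sigma_strategy n w c A B) t = W 1"
proof -
  let ?p = "play (sigma_strategy n w c A B) t n"
  have "measure_pmf.expectation ?p (\<lambda>h. total_payoff w PlayerI h + total_payoff w PlayerII h)
      = measure_pmf.expectation ?p (\<lambda>_. W 1)"
    using play_against_sigma[OF assms order_refl]
    by (intro integral_cong_AE) (auto simp: AE_measure_pmf_iff)
  then show ?thesis unfolding payoff_sum by simp
qed

lemma tau_mirror: "tau_strategy n w c A B \<circ> mirror = sigma_strategy n w c B A"
  by (simp add: tau_eq_mirrored_sigma comp_def)

lemma payoff_against_tau: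
  assumes "s \<in> strategies n c PlayerI A"
  shows "expected_payoff n w p s (tau_strategy n w c A B)
    = expected_payoff n w (opponent p) (sigma_strategy n w c B A) (s \<circ> mirror)"
  using expected_payoff_mirror[OF assms tau_in_strategies, of w "opponent p" w A B]
  by (simp add: tau_mirror)

lemma payoff_sum_tau:
  assumes "funded 1 B" "0 \<le> A" and s: "s \<in> strategies n c PlayerI A"
  shows "expected_payoff n w PlayerI s (tau_strategy n w c A B)
    + expected_payoff n w PlayerII s (tau_strategy n w c A B) = W 1"
  using payoff_sum_sigma[OF assms(1,2)] strategies_mirror[OF s]
  by (simp add: payoff_against_tau[OF s] add.commute)

lemma tau_guarantee:
  assumes B: "funded 1 B" and A: "0 \<le> A" and s: "s \<in> strategies n c PlayerI A"
  shows "B * W 1 / (A + B) \<le> expected_payoff n w PlayerII s (tau_strategy n w c A B)"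
    and "expected_payoff n w PlayerII s (tau_strategy n w c A B) = B * W 1 / (A + B)
      \<Longrightarrow> k < n \<Longrightarrow> h \<in> set_pmf (play s (tau_strategy n w c A B) k)
      \<Longrightarrow> s h = sigma_strategy n w c A B h"
proof -
  have s': "s \<circ> mirror \<in> strategies n c PlayerII A" using strategies_mirror[OF s] by simp
  note guarantee = sigma_guarantee[OF B A s']
  show "B * W 1 / (A + B) \<le> expected_payoff n w PlayerII s (tau_strategy n w c A B)"
    using guarantee(1) by (simp add: payoff_against_tau[OF s] add.commute)
  show "s h = sigma_strategy n w c A B h"
    if eq: "expected_payoff n w PlayerII s (tau_strategy n w c A B) = B * W 1 / (A + B)"
      and k: "k < n" and h: "h \<in> set_pmf (play s (tau_strategy n w c A B) k)"
  proof -
    have "play (sigma_strategy n w c B A) (s \<circ> mirror) k = map_pmf mirror (play s (tau_strategy n w c A B) k)"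
      using play_mirror[of k s "tau_strategy n w c A B"] strategies_nonneg[OF s]
        strategies_nonneg[OF tau_in_strategies, of _ n w c A B] k
      by (simp add: tau_mirror)
    then have "mirror h \<in> set_pmf (play (sigma_strategy n w c B A) (s \<circ> mirror) k)" using h by simp
    moreover have "expected_payoff n w PlayerI (sigma_strategy n w c B A) (s \<circ> mirror) = B * W 1 / (B + A)"
      using eq by (simp add: payoff_against_tau[OF s] add.commute)
    ultimately have "(s \<circ> mirror) (mirror h) = tau_strategy n w c B A (mirror h)"
      using guarantee(2) k by blast
    then show ?thesis by (simp add: tau_eq_mirrored_sigma)
  qed
qed

section \<open>The unique equilibrium\<close>

text \<open>
  Both guarantees are sharp because they add up to \<open>W 1\<close>, the largest possible total payoff. An
  arbitrary equilibrium is compared with \<open>\<sigma>, \<tau>\<close> through the two mixed plays, of \<open>\<sigma>, t'\<close> and of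
  \<open>s', \<tau>\<close>; both turn out to be the play of \<open>\<sigma>, \<tau>\<close>.
\<close>

lemma unique_nash_equilibrium_sigma_tau:
  assumes fA: "funded 1 A" and fB: "funded 1 B" and A: "0 \<le> A" and B: "0 \<le> B" and AB: "0 < A + B"
  shows "expected_payoff n w PlayerI (sigma_strategy n w c A B) (tau_strategy n w c A B) = A * W 1 / (A + B)"
      (is "expected_payoff _ _ _ ?s ?t = ?VI")
    and "expected_payoff n w PlayerII (sigma_strategy n w c A B) (tau_strategy n w c A B) = B * W 1 / (A + B)"
      (is "_ = ?VII")
    and "unique_nash_equilibrium n w c A B (sigma_strategy n w c A B) (tau_strategy n w c A B)"
proof -
  let ?E = "expected_payoff n w"
  have total: "?VI + ?VII = W 1"
    using AB by (simp flip: add_divide_distrib distrib_right)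
  have s: "?s \<in> strategies n c PlayerI A" and t: "?t \<in> strategies n c PlayerII B"
    by (rule sigma_in_strategies tau_in_strategies)+
  note sg = sigma_guarantee[OF fA B] and tg = tau_guarantee[OF fB A]
  note ssum = payoff_sum_sigma[OF fA B] and tsum = payoff_sum_tau[OF fB A]
  show EI: "?E PlayerI ?s ?t = ?VI" and EII: "?E PlayerII ?s ?t = ?VII"
    using sg(1)[OF t] tg(1)[OF s] ssum[OF t] total by linarith+
  have nash: "nash_equilibrium n w c A B ?s ?t"
    unfolding nash_equilibrium_def
  proof (intro conjI ballI s t)
    show "?E PlayerI s' ?t \<le> ?E PlayerI ?s ?t" if "s' \<in> strategies n c PlayerI A" for s'
      using tg(1)[OF that] tsum[OF that] EI total by linarith
    show "?E PlayerII ?s t' \<le> ?E PlayerII ?s ?t" if "t' \<in> strategies n c PlayerII B" for t'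
      using sg(1)[OF that] ssum[OF that] EII total by linarith
  qed
  have "s' h = ?s h \<and> t' h = ?t h"
    if N: "nash_equilibrium n w c A B s' t'" and k: "k < n" and h: "h \<in> set_pmf (play s' t' k)" for s' t' k h
  proof -
    have s': "s' \<in> strategies n c PlayerI A" and t': "t' \<in> strategies n c PlayerII B"
      and le: "?E PlayerI ?s t' \<le> ?E PlayerI s' t'" "?E PlayerII s' ?t \<le> ?E PlayerII s' t'"
      using N s t by (auto simp: nash_equilibrium_def)
    \<comment> \<open>Each player gets at least his guarantee in \<open>s', t'\<close>, and no pair of strategies pays more
        than the sum of the guarantees.\<close>
    have eq: "?E PlayerI ?s t' = ?VI" "?E PlayerII s' ?t = ?VII"
      using le sg(1)[OF t'] tg(1)[OF s'] payoff_sum_le[of s' t'] total by linarith+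
    have t'eq: "t' g = ?t g" if "j < n" "g \<in> set_pmf (play ?s t' j)" for j g
      using sg(2)[OF t' eq(1) that] .
    have s'eq: "s' g = ?s g" if "j < n" "g \<in> set_pmf (play s' ?t j)" for j g
      using tg(2)[OF s' eq(2) that] .
    have "play ?s t' j = play ?s ?t j" if "j < n" for j
      by (rule play_cong) (use that in \<open>simp add: t'eq[OF less_trans]\<close>)
    moreover have "play s' ?t j = play ?s ?t j" if "j < n" for j
      by (rule play_cong) (use that in \<open>simp add: s'eq[OF less_trans]\<close>)
    ultimately have on_path: "s' g = ?s g \<and> t' g = ?t g"
      if "j < n" "g \<in> set_pmf (play ?s ?t j)" for j g
      using s'eq[of j g] t'eq[of j g] that by simp
    have "play ?s ?t k = play s' t' k"
      by (rule play_cong) (use k in \<open>simp add: on_path[OF less_trans]\<close>)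
    with on_path k h show ?thesis by simp
  qed
  with nash show "unique_nash_equilibrium n w c A B ?s ?t"
    by (auto simp: unique_nash_equilibrium_def)
qed

end

theorem theorem3p5:
  fixes n :: nat and w c :: "nat \<Rightarrow> real" and A B W :: real
  assumes "n \<ge> 1"
    and "\<forall>k \<in> {1..n}. w k > 0"
    and "\<forall>k \<in> {1..<n}. c k \<ge> 0"
    and "c n = 0"
    and "A \<ge> 0" and "B \<ge> 0"
    and "A > threshold n w c" and "B > threshold n w c"
  defines "W \<equiv> W_from n w 1"
  shows "unique_nash_equilibrium n w c A B (sigma_strategy n w c A B)
        (tau_strategy n w c A B)
    \<and> expected_payoff n w PlayerI (sigma_strategy n w c A B)
        (tau_strategy n w c A B) = A * W / (A + B)
    \<and> expected_payoff n w PlayerII (sigma_strategy n w c A B)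
        (tau_strategy n w c A B) = B * W / (A + B)
    \<and> (\<forall>t \<in> strategies n c PlayerII B.
         expected_payoff n w PlayerI (sigma_strategy n w c A B) t \<ge> A * W / (A + B))
    \<and> (\<forall>s \<in> strategies n c PlayerI A.
         expected_payoff n w PlayerII s (tau_strategy n w c A B) \<ge> B * W / (A + B))"
proof -
  interpret fee_game n w c
    using assms(2-4) by unfold_locales (auto simp: less_le)
  have funded: "funded 1 A" "funded 1 B"
    using funded_one_if_threshold assms(1,7,8) by auto
  then have "0 < A + B"
    using funded_pos[of 1 A] assms(1,6) by simp
  from unique_nash_equilibrium_sigma_tau[OF funded assms(5,6) this]
    sigma_guarantee(1)[OF funded(1) assms(6)] tau_guarantee(1)[OF funded(2) assms(5)]
  show ?thesis unfolding W_def by blast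
qed

end
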